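(* Let $n\ge 1$ be an integer and let $K$ be a body in $\mathbb{R}^d$. If a sequence of packings $\mathcal{P}_1,\mathcal{P}_2,\mathcal{P}_3,\ldots$ of $K$ increases under the connected $n$-saturation partial ordering, $$\mathcal{P}_1\preceq_{C,n}\mathcal{P}_2\preceq_{C,n}\mathcal{P}_3\preceq_{C,n}\cdots,$$ then it is eventually constant in every bounded region of $\mathbb{R}^d$: for every bounded region $R\subset\mathbb{R}^d$ there is an $N$ such that for all $i\ge N$ the set of elements of $\mathcal{P}_i$ that meet $R$ equals the set of elements of $\mathcal{P}_N$ that meet $R$.
   Context: A domain is a subset of $\mathbb{R}^d$ that is the closure of its interior; a body is a compact domain. A packing of $K$ is a collection of congruent copies of $K$ in $\mathbb{R}^d$ with pairwise disjoint interiors. A connected replacement of order less than $n$ applied to a packing $\mathcal{B}$ of $K$ consists of replacing some $k$ elements of $\mathcal{B}$, where $k<n$, by $k+1$ copies of $K$ so that the result is again a packing of $K$ and the union of the $2k+1$ copies of $K$ involved (the $k$ removed and the $k+1$ inserted) is a connected set. The weak partial ordering $\succeq_{C,n}$ on packings of $K$ is the reflexive transitive relation generated by these replacements: $\mathcal{A}\succeq_{C,n}\mathcal{B}$ (equivalently $\mathcal{B}\preceq_{C,n}\mathcal{A}$) if $\mathcal{A}$ is obtained from $\mathcal{B}$ by a finite (possibly empty) succession of connected replacements of order less than $n$. *)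

theory Defs
  imports "HOL-Analysis.Analysis"
begin

definition is_domain :: "'a::euclidean_space set \<Rightarrow> bool" where
  "is_domain K \<longleftrightarrow> closure (interior K) = K"

definition is_body :: "'a::euclidean_space set \<Rightarrow> bool" where
  "is_body K \<longleftrightarrow> is_domain K \<and> compact K"

(* Congruence is by arbitrary isometries of the ambient space, reflections included;
   in finite dimension distance-preserving maps are automatically surjective. *)
definition congruent_copy :: "'a::euclidean_space set \<Rightarrow> 'a set \<Rightarrow> bool" where
  "congruent_copy K B \<longleftrightarrow>
     (\<exists>f :: 'a \<Rightarrow> 'a. (\<forall>x y. dist (f x) (f y) = dist x y) \<and> B = f ` K)"

definition is_packing :: "'a::euclidean_space set \<Rightarrow> 'a set set \<Rightarrow> bool" where
  "is_packing K P \<longleftrightarrow>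
     (\<forall>B\<in>P. congruent_copy K B) \<and>
     pairwise (\<lambda>A B. interior A \<inter> interior B = {}) P"

(* The condition T \<inter> (B - S) = {} makes the inserted copies additional to the ones that
   are kept: without it, a copy already present could be counted as inserted, since
   collections are sets. *)
definition connected_replacement ::
  "'a::euclidean_space set \<Rightarrow> nat \<Rightarrow> 'a set set \<Rightarrow> 'a set set \<Rightarrow> bool" where
  "connected_replacement K n B A \<longleftrightarrow>
     is_packing K B \<and> is_packing K A \<and>
     (\<exists>k S T. k < n \<and>
        S \<subseteq> B \<and> finite S \<and> card S = k \<and>
        finite T \<and> card T = k + 1 \<and> T \<inter> (B - S) = {} \<and>
        A = (B - S) \<union> T \<and>
        connected (\<Union>S \<union> \<Union>T))"

definition conn_sat_le ::
  "'a::euclidean_space set \<Rightarrow> nat \<Rightarrow> 'a set set \<Rightarrow> 'a set set \<Rightarrow> bool" where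
  "conn_sat_le K n B A \<longleftrightarrow> (connected_replacement K n)\<^sup>*\<^sup>* B A"

end

theory Submission
  imports Defs
begin

text \<open>
  Give a packing the potential obtained by integrating the weight exp (- c |x|) over the union of
  the interiors of its members; it is bounded by the finite total mass, uniformly over all packings.
  The sets involved in a connected replacement of order less than n form a connected union of at
  most 2n - 1 congruent copies, so they lie within a fixed distance L of each other, and the weight
  varies among them by a factor at most exp (2 c L). For small c this is below 1 + 1/(2n), so
  trading k < n copies for k + 1 increases the potential, and by at least a fixed amount
  whenever the replacement meets a given bounded region. Hence only finitely many replacements
  meet that region. Interiors are used because the boundary of a body may have positive volume.
\<close>

section \<open>Isometries and Lebesgue measure of open sets\<close>

text \<open>After subtracting f 0 the map preserves distances and fixes 0, so it is linear and
  orthogonal, and hence onto.\<close>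

lemma isometry_surj:
  fixes f :: "'a::euclidean_space \<Rightarrow> 'a"
  assumes "\<And>x y. dist (f x) (f y) = dist x y"
  shows "surj f"
proof -
  define g where "g x = f x - f 0" for x
  have "orthogonal_transformation g"
    using assms by (simp add: orthogonal_transformation_isometry g_def dist_norm)
  then have "surj g"
    by (rule orthogonal_transformation_surj)
  then show ?thesis
    unfolding g_def surj_def by (metis add_diff_cancel diff_add_cancel)
qed

lemma isometry_inj:
  assumes "\<And>x y. dist (f x) (f y) = dist x y"
  shows "inj f"
  using assms by (metis dist_eq_0_iff injI)

lemma isometry_image_ball:
  fixes f :: "'a::euclidean_space \<Rightarrow> 'a"
  assumes "\<And>x y. dist (f x) (f y) = dist x y"
  shows "f ` ball c r = ball (f c) r"
proof (intro equalityI subsetI)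
  fix y assume y: "y \<in> ball (f c) r"
  obtain x where "y = f x"
    using isometry_surj[OF assms] by blast
  with y assms[of c x] show "y \<in> f ` ball c r"
    by simp
qed (auto simp: assms)

text \<open>Interior points are characterized by balls, and \<open>f\<close> carries balls onto
  balls of the same radius.\<close>

lemma isometry_image_interior:
  fixes f :: "'a::euclidean_space \<Rightarrow> 'a"
  assumes "\<And>x y. dist (f x) (f y) = dist x y"
  shows "interior (f ` S) = f ` interior S"
proof -
  have iff: "f x \<in> interior (f ` S) \<longleftrightarrow> x \<in> interior S" for x
    using isometry_inj[OF assms]
    by (simp add: mem_interior isometry_image_ball[OF assms, symmetric] inj_image_subset_iff)
  show ?thesis
  proof (intro equalityI subsetI)
    fix y assume y: "y \<in> interior (f ` S)"
    obtain x where "y = f x"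
      using isometry_surj[OF assms] by blast
    with y show "y \<in> f ` interior S"
      by (simp add: iff)
  qed (auto simp: iff)
qed

text \<open>Negative radii are included because the index set of the Vitali covering below also
  contains such pairs; their balls are empty.\<close>

lemma emeasure_ball_cong:
  "emeasure lborel (ball c r) = emeasure lborel (ball d r)" for c d :: "'a::euclidean_space"
proof (cases "r \<ge> 0")
  case True
  then show ?thesis by (simp add: emeasure_ball)
next
  case False
  then show ?thesis by (simp add: ball_empty)
qed

text \<open>
  The library's invariance of Lebesgue measure under orthogonal maps needs a well-ordered index
  type; instead, U is exhausted up to a null set by disjoint balls, which are mapped to balls of the
  same radius.
\<close>
lemma isometry_emeasure_le:
  fixes f :: "'a::euclidean_space \<Rightarrow> 'a"
  assumes f: "\<And>x y. dist (f x) (f y) = dist x y" and U: "open U"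
  shows "emeasure lborel U \<le> emeasure lborel (f ` U)"
proof -
  define I where "I = {i :: 'a \<times> real. ball (fst i) (snd i) \<subseteq> U}"
  define V where "V i = ball (fst i) (snd i)" for i :: "'a \<times> real"
  have "\<exists>i. i \<in> I \<and> x \<in> ball (fst i) (snd i) \<and> snd i < d" if "x \<in> U" "0 < d" for x d
  proof -
    obtain e where "e > 0" "ball x e \<subseteq> U"
      using U \<open>x \<in> U\<close> open_contains_ball by blast
    then have "(x, min e (d/2)) \<in> I"
      by (auto simp: I_def)
    then show ?thesis
      using \<open>e > 0\<close> \<open>0 < d\<close> by (intro exI[of _ "(x, min e (d/2))"]) auto
  qed
  then obtain C where C: "countable C" "C \<subseteq> I"
    "pairwise (\<lambda>i j. disjnt (ball (fst i) (snd i)) (ball (fst j) (snd j))) C"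
    "negligible (U - (\<Union>i\<in>C. ball (fst i) (snd i)))"
    using Vitali_covering_theorem_balls[of U I fst snd] by blast
  have VU: "(\<Union>i\<in>C. V i) \<subseteq> U"
    using C(2) by (auto simp: I_def V_def)
  have oV: "open (V i)" "open (f ` V i)" for i
    by (simp_all add: V_def isometry_image_ball f)
  have oU: "open (f ` U)"
    using isometry_image_interior[of f U] f U by (metis interior_open open_interior)
  have disj: "disjoint_family_on V C"
    using C(3) by (auto simp: disjoint_family_on_def pairwise_def disjnt_def V_def)
  have disj': "disjoint_family_on (\<lambda>i. f ` V i) C"
    using disj isometry_inj[of f] f
    unfolding disjoint_family_on_def by (metis image_Int image_empty)
  \<comment> \<open>\<open>negligible\<close> speaks of the completed measure; since the set is
    Borel, nullity passes to \<open>lborel\<close>.\<close>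
  have null: "U - (\<Union>i\<in>C. V i) \<in> null_sets lborel"
  proof -
    have "U - (\<Union>i\<in>C. V i) \<in> sets borel"
      using U oV by (intro sets.Diff borel_open open_UN) auto
    then show ?thesis
      using C(4) by (simp add: negligible_iff_null_sets null_sets_completion_iff V_def)
  qed
  have "emeasure lborel U = emeasure lborel ((\<Union>i\<in>C. V i) \<union> (U - (\<Union>i\<in>C. V i)))"
    using VU by (simp add: Un_absorb1)
  also have "\<dots> = emeasure lborel (\<Union>i\<in>C. V i)"
    using oV null by (intro emeasure_Un_null_set) (auto intro!: borel_open)
  also have "\<dots> = (\<integral>\<^sup>+i. emeasure lborel (V i) \<partial>count_space C)"
    using C(1) disj oV by (intro emeasure_UN_countable) (auto intro!: borel_open)
  also have "\<dots> = (\<integral>\<^sup>+i. emeasure lborel (f ` V i) \<partial>count_space C)"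
    unfolding V_def isometry_image_ball[OF f] by (intro nn_integral_cong emeasure_ball_cong)
  also have "\<dots> = emeasure lborel (\<Union>i\<in>C. f ` V i)"
    using C(1) disj' oV by (intro emeasure_UN_countable[symmetric]) (auto intro!: borel_open)
  also have "\<dots> \<le> emeasure lborel (f ` U)"
    using VU oU by (intro emeasure_mono) (auto intro!: borel_open)
  finally show ?thesis .
qed

text \<open>The reverse inequality comes from applying \<open>isometry_emeasure_le\<close> to the
  inverse map, again an isometry, and the open image of \<open>U\<close>.\<close>

lemma isometry_emeasure_eq:
  fixes f :: "'a::euclidean_space \<Rightarrow> 'a"
  assumes f: "\<And>x y. dist (f x) (f y) = dist x y" and U: "open U"
  shows "emeasure lborel (f ` U) = emeasure lborel U"
proof (rule antisym)
  have s: "surj f" and i: "inj f"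
    using isometry_surj[of f] isometry_inj[of f] f by auto
  have "dist (inv f x) (inv f y) = dist x y" for x y
    using f[of "inv f x" "inv f y"] s by (simp add: surj_f_inv_f)
  moreover have "open (f ` U)"
    using isometry_image_interior[of f U] f U by (metis interior_open open_interior)
  ultimately have "emeasure lborel (f ` U) \<le> emeasure lborel (inv f ` f ` U)"
    by (rule isometry_emeasure_le)
  then show "emeasure lborel (f ` U) \<le> emeasure lborel U"
    using i by (simp add: image_inv_f_f)
qed (rule isometry_emeasure_le[OF assms])

section \<open>Congruent copies and the extent of connected unions\<close>

lemma congruent_copy_emeasure_interior:
  "congruent_copy K B \<Longrightarrow> emeasure lborel (interior B) = emeasure lborel (interior K)"
  by (auto simp: congruent_copy_def isometry_image_interior isometry_emeasure_eq)

lemma congruent_copy_dist_le: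
  assumes "congruent_copy K B" "\<And>x y. x \<in> K \<Longrightarrow> y \<in> K \<Longrightarrow> dist x y \<le> D" "x \<in> B" "y \<in> B"
  shows "dist x y \<le> D"
  using assms by (auto simp: congruent_copy_def)

lemma congruent_copy_eq_empty: "congruent_copy K B \<Longrightarrow> B = {} \<longleftrightarrow> K = {}"
  by (auto simp: congruent_copy_def)

text \<open>
  The function dist x maps the connected union onto an interval containing 0 and dist x y, while
  each member of F is mapped into an interval of length 2 D; compare lengths.
\<close>
lemma connected_Union_dist_le:
  fixes F :: "'a::metric_space set set"
  assumes "finite F" and conn: "connected (\<Union>F)"
    and D: "\<And>B x y. B \<in> F \<Longrightarrow> x \<in> B \<Longrightarrow> y \<in> B \<Longrightarrow> dist x y \<le> D" and "D \<ge> 0"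
    and x: "x \<in> \<Union>F" and y: "y \<in> \<Union>F"
  shows "dist x y \<le> 2 * D * card F"
proof -
  have "\<exists>a. dist x ` B \<subseteq> {a - D..a + D}" if "B \<in> F" for B
  proof (cases "B = {}")
    case False
    then obtain b where b: "b \<in> B" by blast
    have "dist x z \<in> {dist x b - D..dist x b + D}" if "z \<in> B" for z
      using D[OF \<open>B \<in> F\<close> b that] dist_triangle[of x z b] dist_triangle[of x b z]
      by (auto simp: dist_commute)
    then show ?thesis by blast
  qed simp
  then obtain a where a: "\<And>B. B \<in> F \<Longrightarrow> dist x ` B \<subseteq> {a B - D..a B + D}"
    by metis
  have "connected (dist x ` \<Union>F)"
    by (intro connected_continuous_image conn continuous_intros)
  moreover have "0 \<in> dist x ` \<Union>F" "dist x y \<in> dist x ` \<Union>F"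
    using x y by (auto simp: image_iff intro: bexI[of _ x])
  ultimately have "{0..dist x y} \<subseteq> dist x ` \<Union>F"
    by (rule connected_contains_Icc)
  also have "\<dots> \<subseteq> (\<Union>B\<in>F. {a B - D..a B + D})"
    using a by blast
  finally have "emeasure lborel {0..dist x y} \<le> emeasure lborel (\<Union>B\<in>F. {a B - D..a B + D})"
    using \<open>finite F\<close> by (intro emeasure_mono) auto
  also have "\<dots> \<le> (\<Sum>B\<in>F. emeasure lborel {a B - D..a B + D})"
    using \<open>finite F\<close> by (intro emeasure_subadditive_finite) auto
  also have "\<dots> = ennreal (2 * D * card F)"
    using \<open>D \<ge> 0\<close> by (simp add: ennreal_of_nat_eq_real_of_nat mult_ac flip: ennreal_mult)
  finally show ?thesis
    using \<open>D \<ge> 0\<close> by simp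
qed

section \<open>The exponentially weighted measure\<close>

text \<open>The exponential beats the power d + 2, so the terms are at most a constant times 1 / (k
  + 1)^2. With d the dimension, this series bounds the total weighted mass.\<close>

lemma summable_power_exp:
  fixes c :: real
  assumes "c > 0"
  shows "summable (\<lambda>k. exp (- c * real k) * (real k + 1) ^ d)"
proof -
  have "filterlim (\<lambda>k. c * real (Suc k)) at_top sequentially"
    using assms
    by (intro filterlim_tendsto_pos_mult_at_top[OF tendsto_const] filterlim_compose[OF filterlim_real_sequentially filterlim_Suc])
  from filterlim_compose[OF tendsto_power_div_exp_0 this]
  have "(\<lambda>k. (c * real (Suc k)) ^ (d + 2) / exp (c * real (Suc k))) \<longlonglongrightarrow> 0" .
  then have "Bseq (\<lambda>k. (c * real (Suc k)) ^ (d + 2) / exp (c * real (Suc k)))"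
    by (intro convergent_imp_Bseq convergentI)
  then obtain M where M: "\<And>k. norm ((c * real (Suc k)) ^ (d + 2) / exp (c * real (Suc k))) \<le> M"
    unfolding Bseq_def by blast
  \<comment> \<open>The factor exp c pays for the shift from k + 1 to k in the exponent; the shift
    itself matches the base k + 1 and avoids a zero denominator at k = 0.\<close>
  have "summable (\<lambda>k. M * exp c / c ^ (d + 2) * (1 / real (Suc k) ^ 2))"
    using summable_Suc_iff[of "\<lambda>k. 1 / real k ^ 2"] inverse_power_summable[of 2, where ?'a=real]
    by (intro summable_mult) (simp add: inverse_eq_divide)
  then show ?thesis
  proof (rule summable_comparison_test'[where N=0])
    fix k :: nat
    have "(c * real (Suc k)) ^ (d + 2) \<le> M * exp (c * real (Suc k))"
      using M[of k] assms by (simp add: divide_simps)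
    moreover have "exp (c * real (Suc k)) = exp c * exp (c * k)"
      by (simp add: distrib_left flip: exp_add)
    ultimately have "c ^ (d + 2) * (real (Suc k) ^ 2 * real (Suc k) ^ d) \<le> M * exp c * exp (c * k)"
      by (simp only: power_mult_distrib power_add mult_ac)
    then show "norm (exp (- c * real k) * (real k + 1) ^ d) \<le> M * exp c / c ^ (d + 2) * (1 / real (Suc k) ^ 2)"
      using assms by (simp add: exp_minus field_simps add_ac)
  qed
qed

text \<open>For c > 0 the density is integrable, and between points at distance at most L it varies
  by a factor of at most exp (c L), no matter how far from the origin they are.\<close>

definition exp_weight :: "real \<Rightarrow> 'a::euclidean_space measure" where
  "exp_weight c = density lborel (\<lambda>x. ennreal (exp (- c * norm x)))"

lemma sets_exp_weight [simp, measurable_cong]: "sets (exp_weight c) = sets borel"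
  by (simp add: exp_weight_def)

text \<open>On the shell where k <= |x| < k + 1 the density is at most exp (- c k), and the shell
  lies in the ball of radius k + 1, whose volume is a multiple of (k + 1)^d for d the
  dimension.\<close>

lemma finite_measure_exp_weight:
  assumes "c > 0"
  shows "finite_measure (exp_weight c :: 'a::euclidean_space measure)"
proof (rule finite_measureI)
  let ?d = "DIM('a)"
  let ?t = "\<lambda>k x. ennreal (exp (- c * real k)) * indicator (ball (0::'a) (real k + 1)) x"
  have bd: "ennreal (exp (- c * norm x)) \<le> (\<Sum>k. ?t k x)" for x :: 'a
  proof -
    define m where "m = nat \<lfloor>norm x\<rfloor>"
    have m: "real m \<le> norm x" "norm x < real m + 1"
      by (simp_all add: m_def)
    have "ennreal (exp (- c * norm x)) \<le> ?t m x"
      using m \<open>c > 0\<close> by (simp add: ennreal_leI)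
    also have "\<dots> \<le> (\<Sum>k. ?t k x)"
      using sum_le_suminf[of "\<lambda>k. ?t k x" "{m}"]
      by (simp del: sum_mult_indicator)
    finally show ?thesis .
  qed
  have "emeasure (exp_weight c) (space (exp_weight c :: 'a measure)) = (\<integral>\<^sup>+x. ennreal (exp (- c * norm (x::'a))) \<partial>lborel)"
    by (simp add: exp_weight_def emeasure_density)
  also have "\<dots> \<le> (\<integral>\<^sup>+x. (\<Sum>k. ?t k x) \<partial>lborel)"
    by (intro nn_integral_mono bd)
  also have "\<dots> = (\<Sum>k. \<integral>\<^sup>+x. ?t k x \<partial>lborel)"
    by (intro nn_integral_suminf borel_measurable_times_ennreal borel_measurable_indicator) auto
  also have "\<dots> = (\<Sum>k. ennreal (unit_ball_vol ?d * (exp (- c * real k) * (real k + 1) ^ ?d)))"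
    by (simp add: nn_integral_cmult_indicator emeasure_ball mult_ac flip: ennreal_mult)
  also have "\<dots> = ennreal (\<Sum>k. unit_ball_vol ?d * (exp (- c * real k) * (real k + 1) ^ ?d))"
    using \<open>c > 0\<close> by (intro suminf_ennreal2 summable_mult summable_power_exp) auto
  finally show "emeasure (exp_weight c) (space (exp_weight c :: 'a measure)) \<noteq> \<infinity>"
    by (auto simp: top_unique)
qed

lemma exp_weight_bounds:
  fixes U :: "'a::euclidean_space set"
  assumes "c > 0" "open U" "emeasure lborel U = ennreal v" "v \<ge> 0" "m \<ge> 0"
    and bd: "\<And>x. x \<in> U \<Longrightarrow> m \<le> exp (- c * norm x) \<and> exp (- c * norm x) \<le> M"
  shows "m * v \<le> measure (exp_weight c) U" "M \<ge> 0 \<Longrightarrow> measure (exp_weight c) U \<le> M * v"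
proof -
  interpret finite_measure "exp_weight c :: 'a measure"
    by (rule finite_measure_exp_weight[OF \<open>c > 0\<close>])
  have U: "U \<in> sets borel" using \<open>open U\<close> by simp
  have eq: "emeasure (exp_weight c) U = (\<integral>\<^sup>+x. ennreal (exp (- c * norm x)) * indicator U x \<partial>lborel)"
    using U by (simp add: exp_weight_def emeasure_density)
  have "ennreal (m * v) = (\<integral>\<^sup>+x. ennreal m * indicator U x \<partial>lborel)"
    using assms U by (simp add: nn_integral_cmult_indicator ennreal_mult)
  also have "\<dots> \<le> emeasure (exp_weight c) U"
    unfolding eq using bd by (intro nn_integral_mono) (auto simp: indicator_def intro: ennreal_leI)
  finally show "m * v \<le> measure (exp_weight c) U"
    using assms by (simp add: emeasure_eq_measure)
  assume "M \<ge> 0"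
  have "emeasure (exp_weight c) U \<le> (\<integral>\<^sup>+x. ennreal M * indicator U x \<partial>lborel)"
    unfolding eq using bd by (intro nn_integral_mono) (auto simp: indicator_def intro: ennreal_leI)
  also have "\<dots> = ennreal (M * v)"
    using assms U \<open>M \<ge> 0\<close> by (simp add: nn_integral_cmult_indicator ennreal_mult)
  finally show "measure (exp_weight c) U \<le> M * v"
    using assms \<open>M \<ge> 0\<close> by (simp add: emeasure_eq_measure)
qed

section \<open>The potential and its gain under replacements\<close>

text \<open>A union of open sets is open, hence measurable whatever the cardinality of the
  packing.\<close>

definition potential :: "real \<Rightarrow> 'a::euclidean_space set set \<Rightarrow> real" where
  "potential c P = measure (exp_weight c) (\<Union>B\<in>P. interior B)"

text \<open>Used with \<open>Q\<close> the kept copies, possibly infinitely many, and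
  \<open>T\<close> first the inserted and then the removed ones.\<close>

lemma potential_Un:
  fixes Q T :: "'a::euclidean_space set set"
  assumes "c > 0" "finite T" "Q \<inter> T = {}"
    and disj: "pairwise (\<lambda>A B. interior A \<inter> interior B = {}) (Q \<union> T)"
  shows "potential c (Q \<union> T) = potential c Q + (\<Sum>B\<in>T. measure (exp_weight c) (interior B))"
proof -
  interpret finite_measure "exp_weight c :: 'a measure"
    by (rule finite_measure_exp_weight[OF \<open>c > 0\<close>])
  have "interior A \<inter> interior B = {}" if "A \<in> Q" "B \<in> T" for A B
    using that \<open>Q \<inter> T = {}\<close> by (intro pairwiseD[OF disj]) auto
  then have "potential c (Q \<union> T) = potential c Q + measure (exp_weight c) (\<Union>B\<in>T. interior B)"
    unfolding potential_def UN_Un by (intro finite_measure_Union) (auto intro!: borel_open)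
  also have "measure (exp_weight c) (\<Union>B\<in>T. interior B) = (\<Sum>B\<in>T. measure (exp_weight c) (interior B))"
    using disj \<open>finite T\<close>
    by (intro finite_measure_finite_Union)
      (auto simp: disjoint_family_on_def pairwise_def intro!: borel_open)
  finally show ?thesis .
qed

text \<open>Let a be the weight at p, let L = 4 n D and q = exp (c L). Each copy involved lies
  within L of p, so its interior has weighted measure between a v / q and a q v. Trading k copies
  for k + 1 gains at least a v ((k + 1) / q - k q), which is at least a v / (2 q) since q^2 <= 1 + 1
  / (2 n) and k < n. The set \<open>U\<close> is the union of the copies involved; leaving p free in
  \<open>U\<close> allows it to be chosen later in a given region.\<close>

lemma connected_replacement_gain:
  fixes K :: "'a::euclidean_space set"
  assumes rep: "connected_replacement K n B A"
    and ne: "K \<noteq> {}" and v: "emeasure lborel (interior K) = ennreal v" "v \<ge> 0"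
    and D: "\<And>x y. x \<in> K \<Longrightarrow> y \<in> K \<Longrightarrow> dist x y \<le> D" and "D \<ge> 0"
    and c: "c > 0" "exp (2 * c * (4 * real n * D)) * (2 * real n) \<le> 2 * real n + 1"
  obtains U where "U \<noteq> {}" "\<And>C. C \<in> (A - B) \<union> (B - A) \<Longrightarrow> C \<subseteq> U"
    "\<And>p. p \<in> U \<Longrightarrow>
      potential c B + v * exp (- c * norm p) / (2 * exp (c * (4 * real n * D))) \<le> potential c A"
proof -
  from rep obtain S T where pk: "is_packing K B" "is_packing K A" and S: "card S < n" "S \<subseteq> B" "finite S"
    and T: "finite T" "card T = card S + 1" "T \<inter> (B - S) = {}" and A: "A = (B - S) \<union> T"
    and conn: "connected (\<Union>S \<union> \<Union>T)"
    unfolding connected_replacement_def by blast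
  \<comment> \<open>At most 2 k + 1 < 2 n copies of diameter at most \<open>D\<close> are involved,
    and \<open>connected_Union_dist_le\<close> allows 2 D for each.\<close>
  define L where "L = 4 * real n * D"
  define q where "q = exp (c * L)"
  define U where "U = \<Union>(S \<union> T)"
  have copy: "congruent_copy K C" if "C \<in> S \<union> T" for C
    using that pk S A by (auto simp: is_packing_def)
  have "L \<ge> 0" using \<open>D \<ge> 0\<close> by (simp add: L_def)
  have "q > 0" by (simp add: q_def)
  have q2: "exp (2 * c * L) = q\<^sup>2"
    by (simp add: q_def mult_ac flip: exp_double)
  have diam: "dist x y \<le> L" if "x \<in> U" "y \<in> U" for x y
  proof -
    have "dist x y \<le> 2 * D * card (S \<union> T)"
      using that conn S T congruent_copy_dist_le[OF copy D] \<open>D \<ge> 0\<close>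
      by (intro connected_Union_dist_le) (auto simp: U_def)
    also have "\<dots> \<le> 2 * D * (2 * real n)"
      using card_Un_le[of S T] S T \<open>D \<ge> 0\<close> by (intro mult_left_mono) auto
    finally show ?thesis by (simp add: L_def mult_ac)
  qed
  have gain: "potential c B + v * exp (- c * norm p) / (2 * q) \<le> potential c A" if p: "p \<in> U" for p
  proof -
    define a where "a = exp (- c * norm p)"
    have bounds: "a / q * v \<le> measure (exp_weight c) (interior C)"
      "measure (exp_weight c) (interior C) \<le> a * q * v" if C: "C \<in> S \<union> T" for C
    proof -
      have ball: "a / q \<le> exp (- c * norm x) \<and> exp (- c * norm x) \<le> a * q" if "x \<in> interior C" for x
      proof -
        have "dist p x \<le> L"
          using diam[OF p, of x] C that interior_subset[of C] by (auto simp: U_def)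
        then have "\<bar>norm p - norm x\<bar> \<le> L"
          using norm_triangle_ineq3[of p x] by (simp add: dist_norm)
        then have "\<bar>c * (norm p - norm x)\<bar> \<le> c * L"
          using \<open>c > 0\<close> by (simp add: abs_mult)
        then have "- c * norm p - c * L \<le> - c * norm x" "- c * norm x \<le> - c * norm p + c * L"
          by (simp_all add: algebra_simps abs_le_iff)
        then show ?thesis
          by (simp add: a_def q_def flip: exp_diff exp_add)
      qed
      have em: "emeasure lborel (interior C) = ennreal v"
        using congruent_copy_emeasure_interior[OF copy[OF C]] v by simp
      show "a / q * v \<le> measure (exp_weight c) (interior C)"
        "measure (exp_weight c) (interior C) \<le> a * q * v"
        using exp_weight_bounds[OF \<open>c > 0\<close> open_interior em \<open>v \<ge> 0\<close> _ ball] \<open>q > 0\<close>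
        by (simp_all add: a_def)
    qed
    \<comment> \<open>Both packings contain the kept part \<open>B - S\<close>, whose contribution
      cancels.\<close>
    have "potential c A = potential c (B - S) + (\<Sum>C\<in>T. measure (exp_weight c) (interior C))"
      using pk T \<open>c > 0\<close> unfolding A is_packing_def by (intro potential_Un) auto
    moreover have "potential c ((B - S) \<union> S) = potential c (B - S) + (\<Sum>C\<in>S. measure (exp_weight c) (interior C))"
      using pk S \<open>c > 0\<close> unfolding is_packing_def
      by (intro potential_Un) (auto simp: Un_absorb2)
    moreover have "(B - S) \<union> S = B"
      using S by blast
    moreover have "(card S + 1) * (a / q * v) \<le> (\<Sum>C\<in>T. measure (exp_weight c) (interior C))"
      using sum_bounded_below[of T "a / q * v"] bounds(1) T by simp
    moreover have "(\<Sum>C\<in>S. measure (exp_weight c) (interior C)) \<le> card S * (a * q * v)"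
      using sum_bounded_above[of S _ "a * q * v"] bounds(2) by simp
    moreover have "card S * (a * q * v) + v * a / (2 * q) \<le> (card S + 1) * (a / q * v)"
    proof -
      have "q\<^sup>2 * (2 * real n) \<le> 2 * real n + 1"
        using c(2) unfolding L_def[symmetric] q2 by simp
      from mult_left_mono[OF this, of "card S"]
      have "card S * q\<^sup>2 * (2 * real n) \<le> card S * (2 * real n + 1)"
        by (simp only: mult.assoc of_nat_0_le_iff)
      \<comment> \<open>After expansion this is just \<open>card S\<close> at most n, the point
        where the bound on the order enters.\<close>
      also have "\<dots> \<le> (card S + 1/2) * (2 * real n)"
        using S by (simp add: algebra_simps)
      finally have "card S * q\<^sup>2 \<le> card S + 1/2"
        using S by simp
      then have "a * v / q * (card S * q\<^sup>2 + 1/2) \<le> a * v / q * (card S + 1)"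
        using \<open>q > 0\<close> \<open>v \<ge> 0\<close> by (intro mult_left_mono) (auto simp: a_def)
      then show ?thesis
        using \<open>q > 0\<close> by (simp add: field_simps power2_eq_square)
    qed
    ultimately show ?thesis by (simp add: a_def)
  qed
  show thesis
  proof
    show "U \<noteq> {}"
    proof -
      \<comment> \<open>\<open>T\<close> has \<open>card S + 1\<close> elements, so it is nonempty
        even if nothing is removed.\<close>
      obtain C where "C \<in> T"
        using T by fastforce
      then show ?thesis
        using copy[of C] congruent_copy_eq_empty[of K C] ne by (auto simp: U_def)
    qed
    show "C \<subseteq> U" if "C \<in> (A - B) \<union> (B - A)" for C
      using that S A by (auto simp: U_def)
    show "potential c B + v * exp (- c * norm p) / (2 * exp (c * (4 * real n * D))) \<le> potential c A"
      if "p \<in> U" for p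
      using gain[OF that] by (simp add: q_def L_def)
  qed
qed

text \<open>No step lowers the potential, and the collection of members meeting \<open>R\<close>
  changes only in a step that inserts or removes a copy meeting \<open>R\<close>. Such a step has a
  point of its \<open>U\<close> in \<open>R\<close>, where the weight is at least exp (- c r), so a
  single one yields the whole gain claimed.\<close>

lemma conn_sat_le_gain:
  fixes K :: "'a::euclidean_space set"
  assumes le: "conn_sat_le K n B A"
    and K: "K \<noteq> {}" "emeasure lborel (interior K) = ennreal v" "v \<ge> 0"
      "\<And>x y. x \<in> K \<Longrightarrow> y \<in> K \<Longrightarrow> dist x y \<le> D" "D \<ge> 0"
    and c: "c > 0" "exp (2 * c * (4 * real n * D)) * (2 * real n) \<le> 2 * real n + 1"
    and R: "R \<subseteq> cball 0 r"
  shows "potential c B \<le> potential c A \<and>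
    ({C \<in> A. C \<inter> R \<noteq> {}} \<noteq> {C \<in> B. C \<inter> R \<noteq> {}} \<longrightarrow>
      potential c B + v * exp (- c * r) / (2 * exp (c * (4 * real n * D))) \<le> potential c A)"
  using le unfolding conn_sat_le_def
proof (induction rule: rtranclp_induct)
  case base
  then show ?case by simp
next
  case (step A A')
  let ?h = "\<lambda>s. v * exp (- c * s) / (2 * exp (c * (4 * real n * D)))"
  obtain U where U: "U \<noteq> {}" "\<And>C. C \<in> (A' - A) \<union> (A - A') \<Longrightarrow> C \<subseteq> U"
    and gain: "\<And>p. p \<in> U \<Longrightarrow> potential c A + ?h (norm p) \<le> potential c A'"
    by (rule connected_replacement_gain[OF step.hyps(2) K c]) (assumption+, rule that)
  have h: "?h s \<ge> 0" for s
    using \<open>v \<ge> 0\<close> by simp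
  obtain p where "p \<in> U"
    using U(1) by blast
  then have mono: "potential c A \<le> potential c A'"
    using gain[of p] h[of "norm p"] by linarith
  have far: "potential c A + ?h r \<le> potential c A'"
    if neq: "{C \<in> A'. C \<inter> R \<noteq> {}} \<noteq> {C \<in> A. C \<inter> R \<noteq> {}}"
  proof -
    obtain C where "C \<in> (A' - A) \<union> (A - A')" "C \<inter> R \<noteq> {}"
      using neq by blast
    then obtain p where p: "p \<in> U" "p \<in> R"
      using U(2) by blast
    have "norm p \<le> r"
      using p R by auto
    then have "?h r \<le> ?h (norm p)"
      using \<open>c > 0\<close> \<open>v \<ge> 0\<close> by (intro divide_right_mono mult_left_mono) auto
    then show ?thesis
      using gain[OF p(1)] by linarith
  qed
  show ?case
  proof (intro conjI impI)
    show "potential c B \<le> potential c A'"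
      using step.IH mono by linarith
    assume neq: "{C \<in> A'. C \<inter> R \<noteq> {}} \<noteq> {C \<in> B. C \<inter> R \<noteq> {}}"
    show "potential c B + ?h r \<le> potential c A'"
    proof (cases "{C \<in> A'. C \<inter> R \<noteq> {}} = {C \<in> A. C \<inter> R \<noteq> {}}")
      case True
      then have "potential c B + ?h r \<le> potential c A"
        using step.IH neq by simp
      then show ?thesis
        using mono by linarith
    next
      case False
      then show ?thesis
        using step.IH far by linarith
    qed
  qed
qed

section \<open>Stabilization in bounded regions\<close>

theorem theorem9:
  fixes K :: "(real ^ 'd) set"
    and n :: nat
    and P :: "nat \<Rightarrow> (real ^ 'd) set set"
  assumes "n \<ge> 1"
    and "is_body K"
    and "\<And>i. i \<ge> 1 \<Longrightarrow> is_packing K (P i)"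
    and "\<And>i. i \<ge> 1 \<Longrightarrow> conn_sat_le K n (P i) (P (i + 1))"
  shows "\<forall>R :: (real ^ 'd) set. bounded R \<longrightarrow>
           (\<exists>N\<ge>1. \<forall>i\<ge>N. {B \<in> P i. B \<inter> R \<noteq> {}} = {B \<in> P N. B \<inter> R \<noteq> {}})"
proof (intro allI impI)
  fix R :: "(real ^ 'd) set"
  assume "bounded R"
  show "\<exists>N\<ge>1. \<forall>i\<ge>N. {B \<in> P i. B \<inter> R \<noteq> {}} = {B \<in> P N. B \<inter> R \<noteq> {}}"
  \<comment> \<open>The empty set satisfies \<open>is_body\<close>, but its copies never meet
    \<open>R\<close>. A nonempty body has nonempty interior, hence positive volume.\<close>
  proof (cases "K = {}")
    case True
    then have none: "{B \<in> P i. B \<inter> R \<noteq> {}} = {}" if "i \<ge> 1" for i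
      using assms(3)[OF that] by (auto simp: is_packing_def congruent_copy_def)
    show ?thesis
    proof (intro exI conjI allI impI)
      show "(1::nat) \<le> 1" ..
      show "{B \<in> P i. B \<inter> R \<noteq> {}} = {B \<in> P 1. B \<inter> R \<noteq> {}}" if "i \<ge> 1" for i
        using none[OF that] none[of 1] by (simp only: order_refl)
    qed
  next
    case False
    \<comment> \<open>Adding 1 to the diameter makes \<open>D\<close> positive at once, as the
      division in the definition of \<open>c\<close> requires.\<close>
    obtain D where D: "D > 0" "\<And>x y. x \<in> K \<Longrightarrow> y \<in> K \<Longrightarrow> dist x y \<le> D"
    proof
      have "bounded K"
        using \<open>is_body K\<close> by (simp add: is_body_def compact_imp_bounded)
      then show "dist x y \<le> diameter K + 1" if "x \<in> K" "y \<in> K" for x y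
        using diameter_bounded_bound[OF _ that] by simp
      show "diameter K + 1 > 0"
        using diameter_ge_0[OF \<open>bounded K\<close>] by simp
    qed
    define v where "v = measure lborel (interior K)"
    have v: "emeasure lborel (interior K) = ennreal v" "v > 0"
    proof -
      have "bounded (interior K)"
        using \<open>is_body K\<close> by (simp add: is_body_def compact_imp_bounded bounded_interior)
      then have fin: "emeasure lborel (interior K) < \<infinity>"
        by (rule emeasure_bounded_finite)
      then show "emeasure lborel (interior K) = ennreal v"
        by (simp add: v_def emeasure_eq_ennreal_measure)
      have "interior K \<noteq> {}"
        using False \<open>is_body K\<close> by (auto simp: is_body_def is_domain_def)
      then have "\<not> negligible (interior K)"
        by (simp add: open_not_negligible)
      then have "emeasure lborel (interior K) \<noteq> 0"
        by (auto simp: negligible_iff_null_sets null_sets_completion_iff null_sets_def)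
      then show "v > 0"
        using fin by (simp add: v_def measure_def enn2real_positive_iff zero_less_iff_neq_zero)
    qed
    \<comment> \<open>Chosen so that exp (2 c L) equals 1 + 1 / (2 n) for L = 4 n D, the extreme
      value that the gain estimate admits.\<close>
    define c where "c = ln (1 + 1 / (2 * real n)) / (2 * (4 * real n * D))"
    have c: "c > 0" "exp (2 * c * (4 * real n * D)) * (2 * real n) \<le> 2 * real n + 1"
    proof -
      show "c > 0"
        using \<open>n \<ge> 1\<close> \<open>D > 0\<close> unfolding c_def
        by (intro divide_pos_pos ln_gt_zero mult_pos_pos) auto
      have "2 * c * (4 * real n * D) = ln (1 + 1 / (2 * real n))"
        using \<open>n \<ge> 1\<close> \<open>D > 0\<close> by (simp add: c_def)
      then have "exp (2 * c * (4 * real n * D)) = 1 + 1 / (2 * real n)"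
        by (simp add: add_pos_nonneg)
      then show "exp (2 * c * (4 * real n * D)) * (2 * real n) \<le> 2 * real n + 1"
        using \<open>n \<ge> 1\<close> by (simp add: field_simps)
    qed
    obtain r where r: "R \<subseteq> cball 0 r"
      using \<open>bounded R\<close> by (auto simp: bounded_iff subset_iff)
    \<comment> \<open>A lower bound, the same for all i, for the gain caused by any change among the
      members meeting \<open>R\<close>.\<close>
    define \<delta> where "\<delta> = v * exp (- c * r) / (2 * exp (c * (4 * real n * D)))"
    have "\<delta> > 0"
      using v by (simp add: \<delta>_def)
    interpret finite_measure "exp_weight c :: (real ^ 'd) measure"
      by (rule finite_measure_exp_weight[OF \<open>c > 0\<close>])
    have bdd: "bdd_above ((\<lambda>i. potential c (P i)) ` {1..})"
      unfolding potential_def by (rule bdd_aboveI2) (rule bounded_measure)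
    \<comment> \<open>From a potential within \<delta> of the supremum, a change in \<open>R\<close>
      at any later time would push the potential to more than the supremum.\<close>
    then obtain N where N: "N \<ge> 1" "(SUP i\<in>{1..}. potential c (P i)) - \<delta> < potential c (P N)"
      using less_cSUP_iff[OF _ bdd, of "(SUP i\<in>{1..}. potential c (P i)) - \<delta>"] \<open>\<delta> > 0\<close> by auto
    have "{B \<in> P i. B \<inter> R \<noteq> {}} = {B \<in> P N. B \<inter> R \<noteq> {}}" if "i \<ge> N" for i
    proof -
      have "conn_sat_le K n (P N) (P i)"
        using that
      proof (induction rule: dec_induct)
        case base
        then show ?case by (simp add: conn_sat_le_def)
      next
        case (step m)
        then have "conn_sat_le K n (P m) (P (Suc m))"
          using assms(4)[of m] N(1) by simp
        with step.IH show ?case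
          unfolding conn_sat_le_def by (rule rtranclp_trans)
      qed
      from conn_sat_le_gain[OF this False v(1) _ D(2) _ c r]
      have "{B \<in> P i. B \<inter> R \<noteq> {}} \<noteq> {B \<in> P N. B \<inter> R \<noteq> {}} \<Longrightarrow> potential c (P N) + \<delta> \<le> potential c (P i)"
        using v(2) D(1) by (simp add: \<delta>_def)
      moreover have "potential c (P i) \<le> (SUP i\<in>{1..}. potential c (P i))"
        using that N(1) by (intro cSUP_upper bdd) auto
      ultimately show ?thesis
        using N(2) by linarith
    qed
    then show ?thesis
      using N(1) by blast
  qed
qed

end
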